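(* Let $c,\alpha,\beta,\gamma\in\mathbb{C}$ with $\Re(c)>\Re(\gamma)>0$, $\Re(\alpha)>0$ and $\Re(\beta)>0$, and let $s,r\in\mathbb{C}$ with $\Re(s)>0$, $\Re(r)>0$. Then for every $z\in\mathbb{C}$, the double Mellin transform in $(p,q)$ of the extended $(p,q)$-Mittag-Leffler function is $$\int_0^\infty\int_0^\infty p^{s-1}q^{r-1}E_{\alpha,\beta}^{\gamma,c}(z;p,q)\,dp\,dq=\frac{\Gamma(s)\Gamma(r)\Gamma(c+r-\gamma)}{\Gamma(\gamma)\Gamma(c-\gamma)}\;{}_2\Psi_2\left[\begin{array}{c}(c,1),(\gamma+s,1)\\(\beta,\alpha),(c+s+r,1)\end{array};z\right].$$
   Context: $B(x,y)$ is the classical beta function and $(c)_n=c(c+1)\cdots(c+n-1)$, $(c)_0=1$, is the Pochhammer symbol. The extended beta function is $B(x,y;p,q)=\int_0^1 t^{x-1}(1-t)^{y-1}\exp\big(-\frac{p}{t}-\frac{q}{1-t}\big)\,dt$ for $\Re(x)>0$, $\Re(y)>0$ and $p,q\ge0$; for $p=q=0$ it is the classical beta function. The extended $(p,q)$-Mittag-Leffler function is, for $p,q\ge 0$ and $\Re(c)>\Re(\gamma)>0$, $$E_{\alpha,\beta}^{\gamma,c}(z;p,q)=\sum_{n=0}^{\infty}\frac{B(\gamma+n,c-\gamma;p,q)}{B(\gamma,c-\gamma)}\frac{(c)_n}{\Gamma(\alpha n+\beta)}\frac{z^n}{n!}.$$ The Wright hypergeometric function is given by the series $${}_2\Psi_2\left[\begin{array}{c}(a_1,\mu_1),(a_2,\mu_2)\\(b_1,\lambda_1),(b_2,\lambda_2)\end{array};z\right]=\sum_{n=0}^\infty\frac{\Gamma(a_1+\mu_1n)\Gamma(a_2+\mu_2n)}{\Gamma(b_1+\lambda_1n)\Gamma(b_2+\lambda_2n)}\frac{z^n}{n!}.$$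 *)

theory Defs
  imports "HOL-Analysis.Analysis"
begin

text \<open>
  The powers are principal complex powers of positive reals. The classical beta function
  is the library's \<^const>\<open>Beta\<close>.
\<close>

definition ext_Beta :: "complex \<Rightarrow> complex \<Rightarrow> real \<Rightarrow> real \<Rightarrow> complex" where
  "ext_Beta x y p q =
     (LBINT t:{0<..<1}. complex_of_real t powr (x - 1) * complex_of_real (1 - t) powr (y - 1) *
        complex_of_real (exp (- p / t - q / (1 - t))))"

text \<open>Arguments in the order \<alpha>, \<beta> (subscripts), \<gamma>, c (superscripts), z, p, q.\<close>

definition ext_Mittag_Leffler ::
    "complex \<Rightarrow> complex \<Rightarrow> complex \<Rightarrow> complex \<Rightarrow> complex \<Rightarrow> real \<Rightarrow> real \<Rightarrow> complex" where
  "ext_Mittag_Leffler \<alpha> \<beta> \<gamma> c z p q =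
     (\<Sum>n. ext_Beta (\<gamma> + of_nat n) (c - \<gamma>) p q / Beta \<gamma> (c - \<gamma>) *
        (pochhammer c n / Gamma (\<alpha> * of_nat n + \<beta>)) * (z ^ n / fact n))"

text \<open>
  The first two pairs are the upper row (a1, m1), (a2, m2), the last two the lower row
  (b1, l1), (b2, l2). The multipliers of n may be complex.
\<close>

fun wright_2Psi2 ::
    "complex \<times> complex \<Rightarrow> complex \<times> complex \<Rightarrow> complex \<times> complex \<Rightarrow> complex \<times> complex \<Rightarrow>
     complex \<Rightarrow> complex" where
  "wright_2Psi2 (a1, m1) (a2, m2) (b1, l1) (b2, l2) z =
     (\<Sum>n. Gamma (a1 + m1 * of_nat n) * Gamma (a2 + m2 * of_nat n) /
          (Gamma (b1 + l1 * of_nat n) * Gamma (b2 + l2 * of_nat n)) * (z ^ n / fact n))"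

end

theory Submission
  imports Defs
begin

text \<open>
  For a single extended beta function the formula is Fubini's theorem: integrating over $p$ and $q$
  under the integral over $t$ gives two scaled Gamma integrals,
  \[ \int_0^\infty p^{s-1} e^{-p/t}\,dp = \Gamma(s)\, t^s, \qquad
     \int_0^\infty q^{r-1} e^{-q/(1-t)}\,dq = \Gamma(r)\, (1-t)^r, \]
  and what remains is the complex beta integral for $B(x+s, y+r)$, so that the double Mellin
  transform of $B(x,y;p,q)$ is $\Gamma(s)\Gamma(r)B(x+s,y+r)$
  (\<open>has_bochner_integral_Mellin_ext_Beta\<close>). With $x = \gamma+n$ and $y = c-\gamma$ this turns each term
  of the Mittag-Leffler series into the corresponding term of the Wright series.

  The transform may be taken term by term if the integrals of the absolute values of the terms have
  a finite sum. Replacing all parameters by their real parts bounds the $n$-th of these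
  integrals, up to its coefficient, by $\Gamma(\Re s)\Gamma(\Re r)B(\Re\gamma+n+\Re s, \Re(c-\gamma)+\Re r)$, which
  decreases in $n$ (\<open>integral_norm_Mellin_ext_Beta_le\<close>, \<open>norm_Beta_add_nat_le\<close>). So it is enough that
  $\sum_n |(c)_n z^n / (\Gamma(\alpha n+\beta)\, n!)|$ converges. As $\alpha$ may be complex, this needs
  a lower bound on $|\Gamma|$ along a ray in the right half plane. Stirling's formula is avoided by
  \[ \frac{\Gamma(w)}{\Gamma(w+\alpha)} = \frac{B(w,\alpha)}{\Gamma(\alpha)}, \]
  whose right-hand side tends to $0$ along $w = \alpha n+\beta$ by dominated convergence in the beta
  integral (\<open>Beta_linear_tendsto_0\<close>); the ratio test then applies
  (\<open>summable_norm_Mittag_Leffler_coeffs\<close>).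
\<close>

section \<open>Complex powers on the half line\<close>

text \<open>
  The power is extended by $0$ to $t \<le> 0$, so that integrals over $(0,\infty)$ and, through
  the product of the values at $t$ and $1-t$, over $(0,1)$ become integrals over the whole line,
  where affine substitutions and Fubini's theorem need no bookkeeping of domains. The exponent is
  $a - 1$, as in the Gamma and beta integrals.
\<close>

definition half_powr :: "complex \<Rightarrow> real \<Rightarrow> complex" where
  "half_powr a t = (if 0 < t then complex_of_real t powr (a - 1) else 0)"

lemma half_powr_exp:
  "half_powr a t = (if 0 < t then exp ((a - 1) * complex_of_real (ln t)) else 0)"
  by (simp add: half_powr_def powr_def Ln_of_real)

lemma half_powr_measurable [measurable]: "half_powr a \<in> borel_measurable borel"
  unfolding half_powr_exp[abs_def] by measurable

text \<open>
  Hence the integral formulas for products of half-line powers and positive factors, used at the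
  real parts of their parameters, also evaluate the integrals of the absolute values.
\<close>

lemma of_real_norm_half_powr:
  "complex_of_real (norm (half_powr a t)) = half_powr (complex_of_real (Re a)) t"
  using exp_of_real[of "(Re a - 1) * ln t", where 'a = complex]
  by (auto simp: half_powr_exp)

lemma half_powr_shift:
  "0 < t \<Longrightarrow> half_powr (a + s) t = half_powr a t * complex_of_real t powr s"
  using powr_add[of "complex_of_real t" "a - 1" s] by (simp add: half_powr_def add_diff_eq diff_add_eq)

lemma half_powr_mult:
  "0 < x \<Longrightarrow> half_powr a (x * t) = complex_of_real x powr (a - 1) * half_powr a t"
  by (cases "0 < t")
    (simp_all add: half_powr_exp powr_def Ln_of_real zero_less_mult_iff ln_mult distrib_left exp_add)

lemma half_powr_eq_0 [simp]: "t \<le> 0 \<Longrightarrow> half_powr a t = 0"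
  by (simp add: half_powr_def)

section \<open>Interchanging integrals\<close>

text \<open>
  The integrals of the absolute values are stated as complex numbers so that the hypothesis can be met
  by the same formula that evaluates the inner integral itself, taken at real parameters.
\<close>

lemma Fubini_has_bochner_integral:
  fixes f :: "'a::euclidean_space \<times> 'b::euclidean_space \<Rightarrow> complex"
  assumes [measurable]: "f \<in> borel_measurable (lborel \<Otimes>\<^sub>M lborel)"
    and inner: "\<And>x. has_bochner_integral lborel (\<lambda>y. f (x, y)) (g x)"
    and inner_norm: "\<And>x. has_bochner_integral lborel (\<lambda>y. complex_of_real (norm (f (x, y)))) (h x)"
    and outer: "has_bochner_integral lborel g A"
    and outer_norm: "integrable lborel h"
  shows "integrable (lborel \<Otimes>\<^sub>M lborel) f"
    and "integral\<^sup>L (lborel \<Otimes>\<^sub>M lborel) f = A"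
    and "has_bochner_integral lborel (\<lambda>y. \<integral>x. f (x, y) \<partial>lborel) A"
proof -
  have h: "(\<integral>y. norm (f (x, y)) \<partial>lborel) = Re (h x)" for x
    using has_bochner_integral_bounded_linear[OF bounded_linear_Re inner_norm[of x]]
    by (simp add: has_bochner_integral_integral_eq)
  show int: "integrable (lborel \<Otimes>\<^sub>M lborel) f"
  proof (rule lborel_pair.Fubini_integrable)
    show "integrable lborel (\<lambda>x. \<integral>y. norm (f (x, y)) \<partial>lborel)"
      unfolding h using integrable_bounded_linear[OF bounded_linear_Re outer_norm] .
    show "AE x in lborel. integrable lborel (\<lambda>y. f (x, y))"
      using inner by (auto simp: has_bochner_integral_iff)
  qed measurable
  have split: "integrable (lborel \<Otimes>\<^sub>M lborel) (\<lambda>(x, y). f (x, y))"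
    using int by simp
  show eq: "integral\<^sup>L (lborel \<Otimes>\<^sub>M lborel) f = A"
    using lborel_pair.integral_fst[OF split] inner outer by (simp add: has_bochner_integral_iff)
  show "has_bochner_integral lborel (\<lambda>y. \<integral>x. f (x, y) \<partial>lborel) A"
    using lborel_pair.integrable_snd[OF split] lborel_pair.integral_snd[OF split] eq
    by (simp add: has_bochner_integral_iff)
qed

lemma has_bochner_integral_prod:
  fixes f :: "'a::euclidean_space \<Rightarrow> complex" and g :: "'b::euclidean_space \<Rightarrow> complex"
  assumes f: "has_bochner_integral lborel f A" and g: "has_bochner_integral lborel g B"
  shows "has_bochner_integral lborel (\<lambda>(x, y). f x * g y) (A * B)"
proof -
  have [measurable]: "f \<in> borel_measurable borel" "g \<in> borel_measurable borel"
    using f g by (auto simp: has_bochner_integral_iff)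
  have ng: "has_bochner_integral lborel (\<lambda>y. complex_of_real (norm (g y)))
      (\<integral>y. complex_of_real (norm (g y)) \<partial>lborel)"
    using g by (auto simp: has_bochner_integral_iff)
  have m: "(\<lambda>(x, y). f x * g y) \<in> borel_measurable (lborel \<Otimes>\<^sub>M lborel)"
    by measurable
  have inner: "has_bochner_integral lborel (\<lambda>y. case (x, y) of (x, y) \<Rightarrow> f x * g y) (f x * B)" for x
    using has_bochner_integral_mult_right[OF g] by simp
  have inner_norm: "has_bochner_integral lborel
      (\<lambda>y. complex_of_real (norm (case (x, y) of (x, y) \<Rightarrow> f x * g y)))
      (complex_of_real (norm (f x)) * (\<integral>y. complex_of_real (norm (g y)) \<partial>lborel))" for x
    using has_bochner_integral_mult_right[OF ng] by (simp add: norm_mult)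
  have outer: "has_bochner_integral lborel (\<lambda>x. f x * B) (A * B)"
    by (rule has_bochner_integral_mult_left[OF f])
  have "integrable lborel (\<lambda>x. complex_of_real (norm (f x)))"
    using f by (auto simp: has_bochner_integral_iff)
  then have outer_norm: "integrable lborel
      (\<lambda>x. complex_of_real (norm (f x)) * (\<integral>y. complex_of_real (norm (g y)) \<partial>lborel))"
    by (rule integrable_mult_left)
  note F = Fubini_has_bochner_integral[OF m inner inner_norm outer outer_norm]
  show ?thesis
    unfolding lborel_prod[symmetric] has_bochner_integral_iff using F(1,2) by blast
qed

section \<open>Gamma and beta integrals with complex parameters\<close>

lemma has_bochner_integral_Gamma:
  assumes "0 < Re s"
  shows "has_bochner_integral lborel (\<lambda>t. half_powr s t * complex_of_real (exp (- t))) (Gamma s)"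
proof -
  have eq: "half_powr s t * complex_of_real (exp (- t)) =
      indicator {0<..} t *\<^sub>R (complex_of_real t powr (s - 1) / of_real (exp t))" for t
    by (auto simp: half_powr_def exp_minus field_simps)
  have m: "(\<lambda>t. half_powr s t * complex_of_real (exp (- t))) \<in> borel_measurable lborel"
    by measurable
  have "integrable lebesgue (\<lambda>t. half_powr s t * complex_of_real (exp (- t)))"
    using absolutely_integrable_Gamma_integral'[OF assms] by (simp add: set_integrable_def eq)
  then have i: "integrable lborel (\<lambda>t. half_powr s t * complex_of_real (exp (- t)))"
    using integrable_completion[OF m] by simp
  have "((\<lambda>t. if t \<in> {0<..} then complex_of_real t powr (s - 1) / of_real (exp t) else 0)
          has_integral Gamma s) UNIV"
    using Gamma_integral_complex'[OF assms] by (simp only: has_integral_restrict_UNIV)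
  also have "(\<lambda>t. if t \<in> {0<..} then complex_of_real t powr (s - 1) / of_real (exp t) else 0) =
     (\<lambda>t. half_powr s t * complex_of_real (exp (- t)))"
    by (auto simp: eq)
  finally have "integral\<^sup>L lborel (\<lambda>t. half_powr s t * complex_of_real (exp (- t))) = Gamma s"
    using has_integral_integral_lborel[OF i] has_integral_unique by blast
  with i show ?thesis by (simp add: has_bochner_integral_iff)
qed

text \<open>The inner integrals of the Mellin transform: substitute $p = x t$ in the Gamma integral.\<close>

lemma has_bochner_integral_Gamma_scaled:
  assumes "0 < Re s" "0 < x"
  shows "has_bochner_integral lborel (\<lambda>p. half_powr s p * complex_of_real (exp (- p / x)))
           (Gamma s * complex_of_real x powr s)"
proof -
  have "has_bochner_integral lborel
      (\<lambda>p. half_powr s (0 + 1 / x * p) * complex_of_real (exp (- (0 + 1 / x * p)))) (Gamma s /\<^sub>R \<bar>1 / x\<bar>)"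
    using has_bochner_integral_Gamma[OF assms(1)] assms(2)
    by (subst lborel_has_bochner_integral_real_affine_iff[symmetric]) auto
  then have "has_bochner_integral lborel
      (\<lambda>p. complex_of_real x powr (s - 1) * (half_powr s (0 + 1 / x * p) * complex_of_real (exp (- (0 + 1 / x * p)))))
      (complex_of_real x powr (s - 1) * (Gamma s /\<^sub>R \<bar>1 / x\<bar>))"
    by (rule has_bochner_integral_mult_right)
  moreover have "complex_of_real x powr (s - 1) * half_powr s (0 + 1 / x * p) = half_powr s p" for p
    using half_powr_mult[of x s "1 / x * p"] assms by simp
  moreover have "complex_of_real x powr (s - 1) * (Gamma s /\<^sub>R \<bar>1 / x\<bar>) = Gamma s * complex_of_real x powr s"
    using assms by (simp add: powr_diff scaleR_conv_of_real)
  ultimately show ?thesis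
    by (simp add: mult.assoc[symmetric])
qed

lemma not_nonpos_Int_Re_pos: "0 < Re z \<Longrightarrow> z \<notin> \<int>\<^sub>\<le>\<^sub>0"
  by (auto elim!: nonpos_Ints_cases')

lemma Gamma_nonzero_Re_pos: "0 < Re z \<Longrightarrow> Gamma z \<noteq> 0"
  by (simp add: Gamma_eq_zero_iff not_nonpos_Int_Re_pos)

text \<open>
  The classical argument: in the double integral
  $\int\int u^{a-1} (x-u)^{b-1} e^{-x}\,du\,dx$ the integral over $x$ comes from the Gamma
  integral by the shift $x = u + v$, giving $\Gamma(a)\Gamma(b)$ in total, and the integral over $u$
  comes from the beta integral $I$ by $u = x t$, giving $\Gamma(a+b)\, I$.
\<close>

lemma has_bochner_integral_Beta:
  assumes a: "0 < Re a" and b: "0 < Re b"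
  shows "has_bochner_integral lborel (\<lambda>t. half_powr a t * half_powr b (1 - t)) (Beta a b)"
proof -
  let ?b = "\<lambda>t. half_powr a t * half_powr b (1 - t)"
  \<comment> \<open>The absolute value is the integrand of the real beta integral.\<close>
  have bb: "norm (?b t) = indicator {0..1} t *\<^sub>R (t powr (Re a - 1) * (1 - t) powr (Re b - 1))" for t
    by (auto simp: half_powr_exp norm_mult powr_def indicator_def)
  have "integrable lborel (\<lambda>t. norm (?b t))"
    unfolding bb using integrable_Beta[OF a b] by (simp add: set_integrable_def)
  then have ib: "integrable lborel ?b"
    by (subst (asm) integrable_norm_iff) auto
  define I where "I = integral\<^sup>L lborel ?b"
  have I: "has_bochner_integral lborel ?b I"
    using ib by (simp add: has_bochner_integral_iff I_def)
  define H where "H a b = (\<lambda>(u, x). half_powr a u * half_powr b (x - u) * complex_of_real (exp (- x)))"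
    for a b
  have inner: "has_bochner_integral lborel (\<lambda>x. H a b (u, x))
      (half_powr a u * complex_of_real (exp (- u)) * Gamma b)" if b: "0 < Re b" for a b u
  proof -
    have "has_bochner_integral lborel
       (\<lambda>x. half_powr b (- u + 1 * x) * complex_of_real (exp (- (- u + 1 * x)))) (Gamma b /\<^sub>R \<bar>1\<bar>)"
      using has_bochner_integral_Gamma[OF b]
      by (subst lborel_has_bochner_integral_real_affine_iff[symmetric]) auto
    from has_bochner_integral_mult_right[OF this, of "half_powr a u * complex_of_real (exp (- u))"]
    show ?thesis
      by (auto simp: H_def field_simps exp_diff exp_minus elim!: has_bochner_integral_cong[THEN iffD1, rotated 3])
  qed
  have "has_bochner_integral lborel (\<lambda>x. \<integral>u. H a b (u, x) \<partial>lborel) (Gamma a * Gamma b)"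
  proof (rule Fubini_has_bochner_integral(3))
    show "H a b \<in> borel_measurable (lborel \<Otimes>\<^sub>M lborel)"
      unfolding H_def by measurable
    show "has_bochner_integral lborel (\<lambda>x. H a b (u, x))
      (half_powr a u * complex_of_real (exp (- u)) * Gamma b)" for u
      by (rule inner[OF b])
    have n: "complex_of_real (norm (H a b (u, x))) = H (of_real (Re a)) (of_real (Re b)) (u, x)" for u x
      by (simp add: H_def norm_mult of_real_norm_half_powr)
    show "has_bochner_integral lborel (\<lambda>x. complex_of_real (norm (H a b (u, x))))
      (half_powr (of_real (Re a)) u * complex_of_real (exp (- u)) * Gamma (of_real (Re b)))" for u
      unfolding n by (rule inner) (use b in simp)
    show "has_bochner_integral lborel (\<lambda>u. half_powr a u * complex_of_real (exp (- u)) * Gamma b)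
       (Gamma a * Gamma b)"
      by (intro has_bochner_integral_mult_left has_bochner_integral_Gamma a)
    show "integrable lborel (\<lambda>u. half_powr (of_real (Re a)) u * complex_of_real (exp (- u)) * Gamma (of_real (Re b)))"
      using has_bochner_integral_Gamma[of "of_real (Re a)"] a
      by (auto simp: has_bochner_integral_iff)
  qed
  moreover have "(\<integral>u. H a b (u, x) \<partial>lborel) = half_powr (a + b) x * complex_of_real (exp (- x)) * I" for x
  proof (cases "0 < x")
    case True
    have "(\<integral>u. H a b (u, x) \<partial>lborel) = \<bar>x\<bar> *\<^sub>R (\<integral>t. H a b (0 + x * t, x) \<partial>lborel)"
      using True by (intro lborel_integral_real_affine) auto
    also have "(\<lambda>t. H a b (0 + x * t, x)) =
       (\<lambda>t. of_real x powr (a - 1) * of_real x powr (b - 1) * complex_of_real (exp (- x)) * ?b t)"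
    proof
      fix t
      have "x - (0 + x * t) = x * (1 - t)"
        by (simp add: algebra_simps)
      then show "H a b (0 + x * t, x) =
          of_real x powr (a - 1) * of_real x powr (b - 1) * complex_of_real (exp (- x)) * ?b t"
        unfolding H_def case_prod_conv
        by (simp only: half_powr_mult[OF True] add_0) (simp only: mult_ac)
    qed
    also have "(\<integral>t. of_real x powr (a - 1) * of_real x powr (b - 1) * complex_of_real (exp (- x)) * ?b t \<partial>lborel)
       = of_real x powr (a - 1) * of_real x powr (b - 1) * complex_of_real (exp (- x)) * I"
      using has_bochner_integral_integral_eq[OF has_bochner_integral_mult_right[OF I]] .
    also have "\<bar>x\<bar> *\<^sub>R \<dots> = half_powr (a + b) x * complex_of_real (exp (- x)) * I"
      using True by (simp add: half_powr_def powr_diff powr_add scaleR_conv_of_real)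
    finally show ?thesis .
  next
    case False
    then have "H a b (u, x) = 0" for u
      by (cases "0 < u") (auto simp: H_def)
    with False show ?thesis by simp
  qed
  ultimately have "has_bochner_integral lborel
       (\<lambda>x. half_powr (a + b) x * complex_of_real (exp (- x)) * I) (Gamma a * Gamma b)"
    by simp
  moreover have "has_bochner_integral lborel
       (\<lambda>x. half_powr (a + b) x * complex_of_real (exp (- x)) * I) (Gamma (a + b) * I)"
    by (intro has_bochner_integral_mult_left has_bochner_integral_Gamma) (use a b in simp)
  ultimately have "Gamma a * Gamma b = Gamma (a + b) * I"
    using has_bochner_integral_eq by blast
  moreover have "Gamma (a + b) \<noteq> 0"
    using a b by (intro Gamma_nonzero_Re_pos) simp
  ultimately have "I = Beta a b" by (simp add: Beta_def field_simps)
  with I show ?thesis by simp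
qed

section \<open>Bounds for the extended and the classical beta function\<close>

lemma ext_Beta_half_powr:
  "ext_Beta x y p q =
     (\<integral>t. half_powr x t * half_powr y (1 - t) * complex_of_real (exp (- p / t - q / (1 - t))) \<partial>lborel)"
  unfolding ext_Beta_def set_lebesgue_integral_def
  by (intro Bochner_Integration.integral_cong) (auto simp: half_powr_def indicator_def)

lemma ext_Beta_Re_conv_norm:
  "ext_Beta (of_real (Re x)) (of_real (Re y)) p q =
     of_real (\<integral>t. norm (half_powr x t * half_powr y (1 - t) *
       complex_of_real (exp (- p / t - q / (1 - t)))) \<partial>lborel)"
  unfolding ext_Beta_half_powr integral_complex_of_real[symmetric]
  by (simp add: norm_mult of_real_norm_half_powr)

lemma norm_ext_Beta_le_Re:
  "norm (ext_Beta x y p q) \<le> norm (ext_Beta (of_real (Re x)) (of_real (Re y)) p q)"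
  unfolding ext_Beta_Re_conv_norm norm_of_real
  unfolding ext_Beta_half_powr using integral_norm_bound by (rule order_trans) simp

text \<open>For nonnegative $p$ and $q$ the exponential factor is at most $1$.\<close>

lemma norm_ext_Beta_le_Beta:
  assumes x: "0 < Re x" and y: "0 < Re y" and p: "0 \<le> p" and q: "0 \<le> q"
  shows "norm (ext_Beta x y p q) \<le> norm (Beta (complex_of_real (Re x)) (complex_of_real (Re y)))"
proof -
  let ?b = "\<lambda>t. half_powr x t * half_powr y (1 - t)"
  have "has_bochner_integral lborel (\<lambda>t. complex_of_real (norm (?b t))) (Beta (of_real (Re x)) (of_real (Re y)))"
    using has_bochner_integral_Beta[of "of_real (Re x)" "of_real (Re y)"] x y
    by (simp add: norm_mult of_real_norm_half_powr)
  from has_bochner_integral_bounded_linear[OF bounded_linear_Re this]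
  have b: "integrable lborel (\<lambda>t. norm (?b t))"
      "(\<integral>t. norm (?b t) \<partial>lborel) = Re (Beta (of_real (Re x)) (of_real (Re y)))"
    by (simp_all add: has_bochner_integral_iff)
  have "norm (ext_Beta x y p q) \<le>
      (\<integral>t. norm (?b t * complex_of_real (exp (- p / t - q / (1 - t)))) \<partial>lborel)"
    unfolding ext_Beta_half_powr by (rule integral_norm_bound)
  also have "\<dots> \<le> (\<integral>t. norm (?b t) \<partial>lborel)"
  proof (rule integral_mono'[OF b(1)])
    fix t
    show "norm (?b t * complex_of_real (exp (- p / t - q / (1 - t)))) \<le> norm (?b t)"
    proof (cases "0 < t \<and> t < 1")
      case True
      then have "0 \<le> p / t" "0 \<le> q / (1 - t)"
        using p q by auto
      then have "exp (- p / t - q / (1 - t)) \<le> 1"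
        by simp
      then show ?thesis
        by (simp add: norm_mult mult_left_le)
    qed (auto simp: not_less)
  qed auto
  also have "\<dots> \<le> norm (Beta (complex_of_real (Re x)) (complex_of_real (Re y)))"
    unfolding b(2) by (rule complex_Re_le_cmod)
  finally show ?thesis .
qed

text \<open>Each step multiplies the value by $(x+n)/(x+n+y) < 1$.\<close>

lemma norm_Beta_add_nat_le:
  fixes x y :: real
  assumes "0 < x" "0 < y"
  shows "norm (Beta (complex_of_real x + of_nat n) (complex_of_real y))
          \<le> norm (Beta (complex_of_real x) (complex_of_real y))"
proof (induction n)
  case (Suc n)
  let ?x = "complex_of_real (x + n)" and ?y = "complex_of_real y"
  have "?x \<notin> \<int>\<^sub>\<le>\<^sub>0"
    using assms by (intro not_nonpos_Int_Re_pos) (simp add: add_pos_nonneg)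
  then have "(?x + ?y) * Beta (?x + 1) ?y = ?x * Beta ?x ?y"
    by (rule Beta_plus1_left)
  then have "norm (?x + ?y) * norm (Beta (?x + 1) ?y) = norm ?x * norm (Beta ?x ?y)"
    by (simp only: norm_mult[symmetric])
  moreover have "norm (?x + ?y) = x + n + y" "norm ?x = x + n"
    using assms by (simp_all only: norm_of_real flip: of_real_add)
  ultimately have "(x + n + y) * norm (Beta (?x + 1) ?y) = (x + n) * norm (Beta ?x ?y)"
    by (simp only:)
  also have "\<dots> \<le> (x + n + y) * norm (Beta ?x ?y)"
    using assms by (intro mult_right_mono) auto
  finally have "norm (Beta (?x + 1) ?y) \<le> norm (Beta ?x ?y)"
    using assms by (subst (asm) mult_le_cancel_left_pos) auto
  with Suc show ?case
    by (simp add: add_ac)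
qed simp

section \<open>The double Mellin transform of the extended beta function\<close>

text \<open>
  The integrand of the triple integral; the exponential is split so that, for fixed $t$, it is a
  product of a function of $p$ and a function of $q$.
\<close>

definition Mellin_kernel :: "complex \<Rightarrow> complex \<Rightarrow> complex \<Rightarrow> complex \<Rightarrow> real \<times> real \<times> real \<Rightarrow> complex" where
  "Mellin_kernel x y s r = (\<lambda>(t, p, q). half_powr x t * half_powr y (1 - t) *
     ((half_powr s p * complex_of_real (exp (- p / t))) *
      (half_powr r q * complex_of_real (exp (- q / (1 - t))))))"

lemma has_bochner_integral_Mellin_kernel:
  assumes s: "0 < Re s" and r: "0 < Re r"
  shows "has_bochner_integral lborel (\<lambda>pq. Mellin_kernel x y s r (t, pq))
           (Gamma s * Gamma r * (half_powr (x + s) t * half_powr (y + r) (1 - t)))"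
proof (cases "0 < t \<and> t < 1")
  case True
  then have t: "0 < t" "0 < 1 - t"
    by auto
  have "half_powr x t * half_powr y (1 - t) *
      ((Gamma s * of_real t powr s) * (Gamma r * of_real (1 - t) powr r)) =
      Gamma s * Gamma r * (half_powr (x + s) t * half_powr (y + r) (1 - t))"
    unfolding half_powr_shift[OF t(1)] half_powr_shift[OF t(2)] by (simp only: mult_ac)
  from has_bochner_integral_mult_right[OF has_bochner_integral_prod[OF
        has_bochner_integral_Gamma_scaled[OF s t(1)] has_bochner_integral_Gamma_scaled[OF r t(2)]],
        of "half_powr x t * half_powr y (1 - t)", unfolded this]
  show ?thesis
    by (simp only: Mellin_kernel_def case_prod_unfold fst_conv snd_conv)
next
  case False
  then have "Mellin_kernel x y s r (t, pq) = 0" for pq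
    by (auto simp: Mellin_kernel_def not_less case_prod_unfold)
  moreover from False have "half_powr (x + s) t * half_powr (y + r) (1 - t) = 0"
    by (auto simp: not_less)
  ultimately show ?thesis
    by (simp only: mult_zero_right has_bochner_integral_zero)
qed

text \<open>Fubini's theorem for the kernel: the integral over $t$ of the previous formula is a beta integral.\<close>

lemma has_bochner_integral_Mellin_ext_Beta:
  assumes "0 < Re x" "0 < Re y" and s: "0 < Re s" and r: "0 < Re r"
  shows "has_bochner_integral lborel (\<lambda>(p, q). half_powr s p * half_powr r q * ext_Beta x y p q)
           (Gamma s * Gamma r * Beta (x + s) (y + r))"
proof -
  have "has_bochner_integral lborel (\<lambda>pq. \<integral>t. Mellin_kernel x y s r (t, pq) \<partial>lborel)
          (Gamma s * Gamma r * Beta (x + s) (y + r))"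
  proof (rule Fubini_has_bochner_integral(3))
    show "Mellin_kernel x y s r \<in> borel_measurable (lborel \<Otimes>\<^sub>M lborel)"
      unfolding Mellin_kernel_def lborel_prod[symmetric] by measurable
    show "has_bochner_integral lborel (\<lambda>pq. Mellin_kernel x y s r (t, pq))
       (Gamma s * Gamma r * (half_powr (x + s) t * half_powr (y + r) (1 - t)))" for t
      by (rule has_bochner_integral_Mellin_kernel[OF s r])
    let ?R = "\<lambda>a. complex_of_real (Re a)"
    have "complex_of_real (norm (Mellin_kernel x y s r (t, pq))) =
        Mellin_kernel (?R x) (?R y) (?R s) (?R r) (t, pq)" for t pq
      by (simp add: Mellin_kernel_def case_prod_unfold norm_mult of_real_norm_half_powr)
    then show "has_bochner_integral lborel (\<lambda>pq. complex_of_real (norm (Mellin_kernel x y s r (t, pq))))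
       (Gamma (?R s) * Gamma (?R r) * (half_powr (?R x + ?R s) t * half_powr (?R y + ?R r) (1 - t)))" for t
      using has_bochner_integral_Mellin_kernel[of "?R s" "?R r"] s r by simp
    show "has_bochner_integral lborel
        (\<lambda>t. Gamma s * Gamma r * (half_powr (x + s) t * half_powr (y + r) (1 - t)))
        (Gamma s * Gamma r * Beta (x + s) (y + r))"
      by (intro has_bochner_integral_mult_right has_bochner_integral_Beta) (use assms in auto)
    have "has_bochner_integral lborel
        (\<lambda>t. half_powr (?R x + ?R s) t * half_powr (?R y + ?R r) (1 - t)) (Beta (?R x + ?R s) (?R y + ?R r))"
      by (intro has_bochner_integral_Beta) (use assms in auto)
    then show "integrable lborel (\<lambda>t. Gamma (?R s) * Gamma (?R r) *
        (half_powr (?R x + ?R s) t * half_powr (?R y + ?R r) (1 - t)))"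
      by (intro integrable_mult_right) (auto simp: has_bochner_integral_iff)
  qed
  moreover have "(\<integral>t. Mellin_kernel x y s r (t, p, q) \<partial>lborel) =
      half_powr s p * half_powr r q * ext_Beta x y p q" for p q
  proof -
    have "Mellin_kernel x y s r (t, p, q) = half_powr s p * half_powr r q *
        (half_powr x t * half_powr y (1 - t) * complex_of_real (exp (- p / t - q / (1 - t))))" for t
    proof -
      have "exp (- p / t - q / (1 - t)) = exp (- p / t) * exp (- q / (1 - t))"
        by (simp flip: exp_add)
      then show ?thesis
        unfolding Mellin_kernel_def case_prod_conv of_real_mult by (simp only: of_real_mult mult_ac)
    qed
    then show ?thesis
      unfolding ext_Beta_half_powr by (simp only: integral_mult_right_zero)
  qed
  then have "(\<lambda>pq. \<integral>t. Mellin_kernel x y s r (t, pq) \<partial>lborel) =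
      (\<lambda>(p, q). half_powr s p * half_powr r q * ext_Beta x y p q)"
    by auto
  ultimately show ?thesis
    by (simp only:)
qed

text \<open>
  The absolute value of the integrand is at most the integrand at the real parts of the
  parameters, whose integral the previous lemma gives. The norm on the right-hand side only
  turns that positive number, which is represented as a complex one, into a real.
\<close>

lemma integral_norm_Mellin_ext_Beta_le:
  assumes "0 < Re x" "0 < Re y" and s: "0 < Re s" and r: "0 < Re r"
  shows "(\<integral>(p, q). norm (half_powr s p * half_powr r q * ext_Beta x y p q) \<partial>lborel)
    \<le> norm (Gamma (complex_of_real (Re s)) * Gamma (complex_of_real (Re r)) *
         Beta (complex_of_real (Re x + Re s)) (complex_of_real (Re y + Re r)))"
    (is "?lhs \<le> norm ?M")
proof -
  let ?R = "\<lambda>a. complex_of_real (Re a)"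
  let ?g = "\<lambda>(p, q). half_powr (?R s) p * half_powr (?R r) q * ext_Beta (?R x) (?R y) p q"
  have g: "has_bochner_integral lborel ?g ?M"
    using has_bochner_integral_Mellin_ext_Beta[of "?R x" "?R y" "?R s" "?R r"] assms by simp
  have le: "norm (half_powr s p * half_powr r q * ext_Beta x y p q) \<le> Re (?g (p, q))" for p q
  proof -
    obtain e where e: "ext_Beta (?R x) (?R y) p q = complex_of_real e" "0 \<le> e"
      by (rule that[OF ext_Beta_Re_conv_norm]) simp
    then have "norm (ext_Beta x y p q) \<le> e"
      using norm_ext_Beta_le_Re[of x y p q] by simp
    then have "norm (half_powr s p * half_powr r q * ext_Beta x y p q)
        \<le> norm (half_powr s p) * norm (half_powr r q) * e"
      unfolding norm_mult by (intro mult_left_mono) auto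
    also have "\<dots> = Re (?g (p, q))"
      unfolding case_prod_conv e(1) of_real_norm_half_powr[symmetric] by simp
    finally show ?thesis .
  qed
  have Re_g: "has_bochner_integral lborel (\<lambda>x. Re (?g x)) (Re ?M)"
    by (rule has_bochner_integral_bounded_linear[OF bounded_linear_Re g])
  have "?lhs \<le> (\<integral>x. Re (?g x) \<partial>lborel)"
  proof (rule integral_mono')
    show "integrable lborel (\<lambda>x. Re (?g x))"
      using Re_g by (simp only: has_bochner_integral_iff)
    fix u :: "real \<times> real"
    obtain p q where u: "u = (p, q)"
      by fastforce
    show "(case u of (p, q) \<Rightarrow> norm (half_powr s p * half_powr r q * ext_Beta x y p q)) \<le> Re (?g u)"
      using le[of p q] by (simp only: u case_prod_conv)
    show "0 \<le> Re (?g u)"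
      using order_trans[OF norm_ge_zero le[of p q]] by (simp only: u)
  qed
  also have "\<dots> = Re ?M"
    using Re_g by (simp only: has_bochner_integral_iff)
  also have "\<dots> \<le> norm ?M"
    by (rule complex_Re_le_cmod)
  finally show ?thesis .
qed

section \<open>Absolute convergence of the Mittag-Leffler series\<close>

text \<open>
  The beta integrand at $\alpha n + \beta$ is the one at $\beta$ times $(t^\alpha)^n$, and
  $|t^\alpha| < 1$ for $0 < t < 1$.
\<close>

lemma Beta_linear_tendsto_0:
  assumes \<alpha>: "0 < Re \<alpha>" and \<beta>: "0 < Re \<beta>" and b: "0 < Re b"
  shows "(\<lambda>n. Beta (\<alpha> * of_nat n + \<beta>) b) \<longlonglongrightarrow> 0"
proof -
  let ?s = "\<lambda>n t. half_powr (\<alpha> * of_nat n + \<beta>) t * half_powr b (1 - t)"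
  have eq: "?s n t = half_powr \<beta> t * half_powr b (1 - t) * (of_real t powr \<alpha>) ^ n" if "0 < t" for n t
  proof -
    have "complex_of_real t powr (\<alpha> * of_nat n) = (complex_of_real t powr \<alpha>) ^ n"
      using that by (simp add: powr_def exp_of_nat_mult[symmetric] mult_ac)
    then show ?thesis
      using half_powr_shift[OF that, of \<beta> "\<alpha> * of_nat n"] by (simp add: add.commute)
  qed
  have lt1: "norm (complex_of_real t powr \<alpha>) < 1" if "0 < t" "t < 1" for t
    using that \<alpha> by (simp add: norm_powr_real_powr powr01_less_one)
  have "(\<lambda>n. \<integral>t. ?s n t \<partial>lborel) \<longlonglongrightarrow> (\<integral>t. (0 :: complex) \<partial>(lborel :: real measure))"
  proof (rule integral_dominated_convergence[where w = "\<lambda>t. norm (half_powr \<beta> t * half_powr b (1 - t))"])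
    show "integrable lborel (\<lambda>t. norm (half_powr \<beta> t * half_powr b (1 - t)))"
      using has_bochner_integral_Beta[OF \<beta> b] by (auto simp: has_bochner_integral_iff)
    have "(\<lambda>n. ?s n t) \<longlonglongrightarrow> 0" for t
    proof (cases "0 < t \<and> t < 1")
      case True
      then have "(\<lambda>n. (complex_of_real t powr \<alpha>) ^ n) \<longlonglongrightarrow> 0"
        by (intro LIMSEQ_power_zero lt1) auto
      with True show ?thesis
        by (auto simp: eq intro: tendsto_mult_right_zero)
    qed (auto simp: not_less)
    then show "AE t in lborel. (\<lambda>n. ?s n t) \<longlonglongrightarrow> 0"
      by simp
    have "norm (?s n t) \<le> norm (half_powr \<beta> t * half_powr b (1 - t))" for n t
    proof (cases "0 < t \<and> t < 1")
      case True
      then have "norm (complex_of_real t powr \<alpha>) ^ n \<le> 1"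
        using lt1[of t] by (intro power_le_one) auto
      with True show ?thesis
        by (simp add: eq norm_mult norm_power mult_left_le)
    qed (auto simp: not_less)
    then show "AE t in lborel. norm (?s n t) \<le> norm (half_powr \<beta> t * half_powr b (1 - t))" for n
      by simp
  qed measurable
  moreover have "(\<integral>t. ?s n t \<partial>lborel) = Beta (\<alpha> * of_nat n + \<beta>) b" for n
    using \<alpha> \<beta> b by (intro has_bochner_integral_integral_eq has_bochner_integral_Beta) (auto intro: add_nonneg_pos)
  ultimately show ?thesis
    by simp
qed

text \<open>
  Consecutive terms have ratio $\frac{c+n}{n+1}\, z\, B(\alpha n+\beta, \alpha) / \Gamma(\alpha)$, which
  tends to $0$.
\<close>

lemma summable_norm_Mittag_Leffler_coeffs:
  fixes c \<alpha> \<beta> z :: complex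
  assumes \<alpha>: "0 < Re \<alpha>" and \<beta>: "0 < Re \<beta>"
  shows "summable (\<lambda>n. norm (pochhammer c n / Gamma (\<alpha> * of_nat n + \<beta>) * (z ^ n / fact n)))"
proof -
  let ?f = "\<lambda>n. pochhammer c n / Gamma (\<alpha> * of_nat n + \<beta>) * (z ^ n / fact n)"
  let ?B = "\<lambda>n. Beta (\<alpha> * of_nat n + \<beta>) \<alpha>"
  let ?C = "(norm c + 1) * norm z / norm (Gamma \<alpha>)"
  have ratio: "norm (?f (Suc n)) \<le> ?C * norm (?B n) * norm (?f n)" for n
  proof -
    let ?w = "\<alpha> * of_nat n + \<beta>"
    have Re_w: "0 < Re ?w"
      using \<alpha> \<beta> by (simp add: add_nonneg_pos)
    have [simp]: "Gamma ?w \<noteq> 0" "Gamma \<alpha> \<noteq> 0" "Gamma (?w + \<alpha>) \<noteq> 0"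
      using Re_w \<alpha> by (auto intro!: Gamma_nonzero_Re_pos add_pos_pos)
    have "1 / Gamma (?w + \<alpha>) = ?B n / Gamma \<alpha> * (1 / Gamma ?w)"
      by (simp add: Beta_def)
    moreover have "\<alpha> * of_nat (Suc n) + \<beta> = ?w + \<alpha>"
      by (simp add: algebra_simps)
    ultimately have "1 / Gamma (\<alpha> * of_nat (Suc n) + \<beta>) = ?B n / Gamma \<alpha> * (1 / Gamma ?w)"
      by (simp only:)
    then have "?f (Suc n) = ((c + of_nat n) / of_nat (Suc n)) * z * (?B n / Gamma \<alpha>) * ?f n"
      by (simp add: pochhammer_Suc divide_inverse mult_ac del: of_nat_Suc)
    then have "norm (?f (Suc n)) =
        norm ((c + of_nat n) / of_nat (Suc n)) * (norm z * (norm (?B n) / norm (Gamma \<alpha>)) * norm (?f n))"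
      by (simp add: norm_mult norm_divide del: of_nat_Suc)
    also have "\<dots> \<le> (norm c + 1) * (norm z * (norm (?B n) / norm (Gamma \<alpha>)) * norm (?f n))"
    proof (rule mult_right_mono)
      have "norm (c + of_nat n) \<le> norm c + n"
        using norm_triangle_ineq[of c "of_nat n"] by simp
      also have "\<dots> \<le> (norm c + 1) * Suc n"
        by (simp add: algebra_simps)
      finally show "norm ((c + of_nat n) / of_nat (Suc n)) \<le> norm c + 1"
        by (simp add: norm_divide divide_le_eq del: of_nat_Suc)
    qed auto
    finally show ?thesis
      by (simp add: mult_ac)
  qed
  have "(\<lambda>n. ?C * norm (?B n)) \<longlonglongrightarrow> ?C * norm (0 :: complex)"
    by (intro tendsto_intros Beta_linear_tendsto_0 \<alpha> \<beta>)
  then have "\<forall>\<^sub>F n in sequentially. ?C * norm (?B n) < 1 / 2"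
    by (rule order_tendstoD) simp
  then obtain N where N: "?C * norm (?B n) < 1 / 2" if "N \<le> n" for n
    unfolding eventually_sequentially by blast
  show ?thesis
  proof (rule summable_ratio_test)
    show "(1 / 2 :: real) < 1"
      by simp
    show "norm (norm (?f (Suc n))) \<le> 1 / 2 * norm (norm (?f n))" if "N \<le> n" for n
      using order_trans[OF ratio mult_right_mono[OF less_imp_le[OF N[OF that]] norm_ge_zero]] by simp
  qed
qed


section \<open>The double Mellin transform of the Mittag-Leffler function\<close>

theorem theorem2p2:
  fixes c \<alpha> \<beta> \<gamma> s r z :: complex
  assumes "Re c > Re \<gamma>" and "Re \<gamma> > 0" and "Re \<alpha> > 0" and "Re \<beta> > 0"
    and "Re s > 0" and "Re r > 0"
  shows "set_integrable lborel ({0<..} \<times> {0<..})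
           (\<lambda>(p, q). complex_of_real p powr (s - 1) * complex_of_real q powr (r - 1) *
              ext_Mittag_Leffler \<alpha> \<beta> \<gamma> c z p q)
       \<and> (LBINT q:{0<..}. LBINT p:{0<..}.
            complex_of_real p powr (s - 1) * complex_of_real q powr (r - 1) *
              ext_Mittag_Leffler \<alpha> \<beta> \<gamma> c z p q) =
         Gamma s * Gamma r * Gamma (c + r - \<gamma>) / (Gamma \<gamma> * Gamma (c - \<gamma>)) *
           wright_2Psi2 (c, 1) (\<gamma> + s, 1) (\<beta>, \<alpha>) (c + s + r, 1) z"
proof -
  define A where "A n = pochhammer c n / Gamma (\<alpha> * of_nat n + \<beta>) * (z ^ n / fact n)" for n
  define B where "B = Beta \<gamma> (c - \<gamma>)"
  define G where "G n = (\<lambda>(p, q). half_powr s p * half_powr r q * ext_Beta (\<gamma> + of_nat n) (c - \<gamma>) p q)" for n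
  define F where "F = (\<lambda>(p, q). half_powr s p * half_powr r q * ext_Mittag_Leffler \<alpha> \<beta> \<gamma> c z p q)"
  \<comment> \<open>Bounds, uniform in the index, for the integrals of the terms and for their values.\<close>
  define M where "M = norm (Gamma (complex_of_real (Re s)) * Gamma (complex_of_real (Re r))) *
    norm (Beta (complex_of_real (Re \<gamma> + Re s)) (complex_of_real (Re (c - \<gamma>) + Re r)))"
  define N where "N = norm (Beta (complex_of_real (Re \<gamma>)) (complex_of_real (Re (c - \<gamma>))))"
  have pos: "0 < Re (\<gamma> + of_nat n)" "0 < Re (c - \<gamma>)" for n
    using assms by auto
  have sumA: "summable (\<lambda>n. norm (A n / B))"
    unfolding A_def norm_divide[of _ B]
    by (intro summable_divide summable_norm_Mittag_Leffler_coeffs assms)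

  have G: "has_bochner_integral lborel (G n)
      (Gamma s * Gamma r * Beta (\<gamma> + of_nat n + s) (c - \<gamma> + r))" for n
    unfolding G_def by (intro has_bochner_integral_Mellin_ext_Beta pos assms)
  have norm_G: "(\<integral>u. norm (G n u) \<partial>lborel) \<le> M" for n
  proof -
    have "(\<integral>u. norm (G n u) \<partial>lborel) \<le> norm (Gamma (complex_of_real (Re s)) * Gamma (complex_of_real (Re r)) *
       Beta (complex_of_real (Re (\<gamma> + of_nat n) + Re s)) (complex_of_real (Re (c - \<gamma>) + Re r)))"
      using integral_norm_Mellin_ext_Beta_le[OF pos assms(5,6), of n]
      by (simp only: G_def case_prod_unfold)
    also have "\<dots> = norm (Gamma (complex_of_real (Re s)) * Gamma (complex_of_real (Re r))) *
       norm (Beta (complex_of_real (Re \<gamma> + Re s) + of_nat n) (complex_of_real (Re (c - \<gamma>) + Re r)))"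
      by (simp add: norm_mult add_ac)
    also have "\<dots> \<le> M"
      unfolding M_def using assms by (intro mult_left_mono norm_Beta_add_nat_le) auto
    finally show ?thesis .
  qed
  have bound_G: "norm (ext_Beta (\<gamma> + of_nat n) (c - \<gamma>) p q) \<le> N" if "0 \<le> p" "0 \<le> q" for n p q
  proof -
    have "norm (ext_Beta (\<gamma> + of_nat n) (c - \<gamma>) p q) \<le>
        norm (Beta (complex_of_real (Re (\<gamma> + of_nat n))) (complex_of_real (Re (c - \<gamma>))))"
      by (intro norm_ext_Beta_le_Beta pos that)
    also have "\<dots> \<le> N"
      using norm_Beta_add_nat_le[of "Re \<gamma>" "Re (c - \<gamma>)" n] assms by (simp add: N_def)
    finally show ?thesis .
  qed
  have sum_ext: "summable (\<lambda>n. norm (A n / B * ext_Beta (\<gamma> + of_nat n) (c - \<gamma>) p q))"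
    if "0 \<le> p" "0 \<le> q" for p q
  proof (rule summable_comparison_test')
    show "summable (\<lambda>n. norm (A n / B) * N)"
      by (intro summable_mult2 sumA)
    show "norm (norm (A n / B * ext_Beta (\<gamma> + of_nat n) (c - \<gamma>) p q)) \<le> norm (A n / B) * N" for n
      unfolding real_norm_def abs_norm_cancel unfolding norm_mult by (intro mult_left_mono bound_G that norm_ge_zero)
  qed
  have norm_term: "norm (A n / B * G n (p, q)) =
      norm (half_powr s p * half_powr r q) * norm (A n / B * ext_Beta (\<gamma> + of_nat n) (c - \<gamma>) p q)" for n p q
    by (simp add: G_def norm_mult norm_divide)
  have F_series: "F u = (\<Sum>n. A n / B * G n u)" for u
  proof -
    obtain p q where u: "u = (p, q)"
      by fastforce
    show ?thesis
    proof (cases "0 < p \<and> 0 < q")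
      case True
      have "F u = half_powr s p * half_powr r q * (\<Sum>n. A n / B * ext_Beta (\<gamma> + of_nat n) (c - \<gamma>) p q)"
        by (simp add: F_def u ext_Mittag_Leffler_def A_def B_def mult_ac)
      also have "\<dots> = (\<Sum>n. half_powr s p * half_powr r q * (A n / B * ext_Beta (\<gamma> + of_nat n) (c - \<gamma>) p q))"
        using True by (intro suminf_mult[symmetric] summable_norm_cancel[OF sum_ext]) auto
      finally show ?thesis
        by (simp add: u G_def mult_ac)
    qed (auto simp: u F_def G_def not_less)
  qed

  have int: "integrable lborel (\<lambda>u. A n / B * G n u)" for n
    using G by (intro integrable_mult_right) (simp add: has_bochner_integral_iff)
  have AE_sum: "AE u in lborel. summable (\<lambda>n. norm (A n / B * G n u))"
  proof (rule AE_I2)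
    fix u :: "real \<times> real"
    obtain p q where u: "u = (p, q)"
      by fastforce
    show "summable (\<lambda>n. norm (A n / B * G n u))"
    proof (cases "0 < p \<and> 0 < q")
      case True
      then show ?thesis
        unfolding u norm_term by (intro summable_mult sum_ext) auto
    qed (auto simp: u G_def not_less)
  qed
  have sum_int: "summable (\<lambda>n. \<integral>u. norm (A n / B * G n u) \<partial>lborel)"
  proof (rule summable_comparison_test')
    show "summable (\<lambda>n. norm (A n / B) * M)"
      by (intro summable_mult2 sumA)
    show "norm (\<integral>u. norm (A n / B * G n u) \<partial>lborel) \<le> norm (A n / B) * M" for n
    proof -
      have "norm (\<integral>u. norm (A n / B * G n u) \<partial>lborel) = norm (A n / B) * (\<integral>u. norm (G n u) \<partial>lborel)"
        by (simp add: norm_mult norm_divide del: times_divide_eq_left)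
      also have "\<dots> \<le> norm (A n / B) * M"
        by (intro mult_left_mono norm_G norm_ge_zero)
      finally show ?thesis .
    qed
  qed
  have int_F: "integrable lborel F"
    using integrable_suminf[OF int AE_sum sum_int] by (simp only: F_series[abs_def])
  have sums_F: "(\<lambda>n. \<integral>u. A n / B * G n u \<partial>lborel) sums integral\<^sup>L lborel F"
    using sums_integral[OF int AE_sum sum_int] by (simp only: F_series[abs_def])

  define W where "W n = Gamma (c + 1 * of_nat n) * Gamma (\<gamma> + s + 1 * of_nat n) /
    (Gamma (\<beta> + \<alpha> * of_nat n) * Gamma (c + s + r + 1 * of_nat n)) * (z ^ n / fact n)" for n
  define C where "C = Gamma s * Gamma r * Gamma (c + r - \<gamma>) / (Gamma \<gamma> * Gamma (c - \<gamma>))"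
  have nz: "Gamma c \<noteq> 0" "Gamma \<gamma> \<noteq> 0" "Gamma (c - \<gamma>) \<noteq> 0" "Gamma s \<noteq> 0" "Gamma r \<noteq> 0"
      "Gamma (c + r - \<gamma>) \<noteq> 0"
    using assms by (auto intro!: Gamma_nonzero_Re_pos)
  have term_eq: "(\<integral>u. A n / B * G n u \<partial>lborel) = C * W n" for n
  proof -
    have "c \<notin> \<int>\<^sub>\<le>\<^sub>0"
      using assms by (intro not_nonpos_Int_Re_pos) auto
    then have poch: "pochhammer c n = Gamma (c + of_nat n) / Gamma c"
      by (rule pochhammer_Gamma)
    have "(\<integral>u. A n / B * G n u \<partial>lborel) =
        A n / B * (Gamma s * Gamma r * Beta (\<gamma> + of_nat n + s) (c - \<gamma> + r))"
      by (rule has_bochner_integral_integral_eq[OF has_bochner_integral_mult_right[OF G]])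
    also have "\<gamma> + of_nat n + s = \<gamma> + s + of_nat n"
      by simp
    also have "c - \<gamma> + r = c + r - \<gamma>"
      by simp
    also have "Beta (\<gamma> + s + of_nat n) (c + r - \<gamma>) =
        Gamma (\<gamma> + s + of_nat n) * Gamma (c + r - \<gamma>) / Gamma (c + s + r + of_nat n)"
      by (simp add: Beta_def algebra_simps)
    also have "A n / B * (Gamma s * Gamma r *
        (Gamma (\<gamma> + s + of_nat n) * Gamma (c + r - \<gamma>) / Gamma (c + s + r + of_nat n))) = C * W n"
    proof -
      have B: "B = Gamma \<gamma> * Gamma (c - \<gamma>) / Gamma c"
        by (simp add: B_def Beta_def)
      show ?thesis
        unfolding B using nz by (simp add: A_def C_def W_def poch divide_inverse mult_ac add.commute)
    qed
    finally show ?thesis .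
  qed
  have "(\<lambda>n. C * W n) sums integral\<^sup>L lborel F"
    using sums_F by (simp only: term_eq)
  \<comment> \<open>The constant must be cancelled to see that the Wright series itself converges.\<close>
  moreover have "C \<noteq> 0"
    using nz by (simp add: C_def)
  ultimately have "summable W"
    by (metis summable_mult_D sums_summable)
  then have "(\<Sum>n. C * W n) = C * suminf W"
    by (rule suminf_mult)
  then have integral_F: "integral\<^sup>L lborel F = C * suminf W"
    using \<open>(\<lambda>n. C * W n) sums integral\<^sup>L lborel F\<close> sums_unique by metis

  \<comment> \<open>By absolute integrability the iterated integral is the integral over the plane.\<close>
  have "(\<integral>q. (\<integral>p. F (p, q) \<partial>lborel) \<partial>lborel) = integral\<^sup>L lborel F"
    using lborel_pair.integral_snd[of "\<lambda>p q. F (p, q)"] int_F by (simp add: lborel_prod)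
  moreover have "(LBINT q:{0<..}. LBINT p:{0<..}. complex_of_real p powr (s - 1) *
      complex_of_real q powr (r - 1) * ext_Mittag_Leffler \<alpha> \<beta> \<gamma> c z p q) =
      (\<integral>q. (\<integral>p. F (p, q) \<partial>lborel) \<partial>lborel)"
    unfolding set_lebesgue_integral_def integral_scaleR_right[symmetric]
    by (intro Bochner_Integration.integral_cong) (auto simp: F_def half_powr_def indicator_def)
  moreover have "set_integrable lborel ({0<..} \<times> {0<..})
           (\<lambda>(p, q). complex_of_real p powr (s - 1) * complex_of_real q powr (r - 1) *
              ext_Mittag_Leffler \<alpha> \<beta> \<gamma> c z p q)"
  proof -
    have "(\<lambda>u. indicat_real ({0<..} \<times> {0<..}) u *\<^sub>R
        (case u of (p, q) \<Rightarrow> complex_of_real p powr (s - 1) * complex_of_real q powr (r - 1) *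
          ext_Mittag_Leffler \<alpha> \<beta> \<gamma> c z p q)) = F"
      by (auto simp: F_def half_powr_def indicator_def)
    with int_F show ?thesis
      by (simp only: set_integrable_def)
  qed
  moreover have "wright_2Psi2 (c, 1) (\<gamma> + s, 1) (\<beta>, \<alpha>) (c + s + r, 1) z = suminf W"
    unfolding W_def[abs_def] by simp
  ultimately show ?thesis
    using integral_F by (simp only: C_def)
qed

end
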